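(* Let $L:\mathbb{R}^n\times\mathbb{R}^n\to\mathbb{R}$ be a loss function, let $t\in\mathbb{R}^n$ be a target, $\tau\in[0,1]$, $\epsilon>0$, and consider the set-based loss $$E(t,\mathcal{Y})=(1-\tau)\,L(t,c)+\frac{\tau}{\epsilon}\,\|\mathcal{Y}\|_F .$$ Given an output set (zonotope) $\mathcal{Y}=\langle c,G\rangle\subset\mathbb{R}^n$, the gradient of the set-based loss function is $$\nabla_{\mathcal{Y}}E(t,\mathcal{Y})=\Big\langle (1-\tau)\,\nabla_c L(t,c),\ \frac{\tau}{\epsilon}\,\frac{1}{n\,\|\mathcal{Y}\|_F}\,G\Big\rangle .$$
   Context: A zonotope with center $c\in\mathbb{R}^n$ and generator matrix $G\in\mathbb{R}^{n\times q}$ is $\langle c,G\rangle=\{c+\sum_{i=1}^q G_{(\cdot,i)}\beta_{(i)}\mid \beta\in[-1,1]^q\}$. The F-radius of a zonotope is $\|\langle c,G\rangle\|_F:=\frac1n\sqrt{\sum_{i=1}^n\sum_{j=1}^q G_{(i,j)}^2}$ (with the normalization factor $1/n$). The gradient of a function $f$ with respect to a zonotope $\mathcal{Z}=\langle c,G\rangle$ is defined as $\nabla_{\mathcal{Z}}f(\mathcal{Z}):=\langle\nabla_c f(\mathcal{Z}),\nabla_G f(\mathcal{Z})\rangle$, where $\nabla_c f$ and $\nabla_G f$ collect the entrywise partial derivatives. Here $\epsilon$ is the perturbation radius of the input set and $\tau$ is a weighting hyperparameter.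
   Formalization: With the F-radius normalized by 1/n, the printed factor 1/(n‖Y‖_F) is wrong for n ≥ 2 when τ ≠ 0; the formal statement has 1/(n²‖Y‖_F). It also assumes that ‖Y‖_F ≠ 0 and that the partial derivatives of L(t,·) exist at c. *)

theory Defs
  imports "HOL-Analysis.Analysis"
begin

text \<open>
  A zonotope is represented by its center and generator matrix. The F-radius and the set-based
  loss depend on this representation and not only on the point set \<open>zonotope_set\<close>: splitting a
  generator into two halves changes the F-radius but not the point set.
\<close>

datatype ('n::finite, 'q::finite) zonotope =
  Zonotope (center: "real ^ 'n") (generators: "real ^ 'q ^ 'n")

definition zonotope_set :: "('n::finite, 'q::finite) zonotope \<Rightarrow> (real ^ 'n) set" where
  "zonotope_set Z =
    {center Z + (\<Sum>i\<in>UNIV. (\<beta> $ i) *\<^sub>R column i (generators Z)) | \<beta>. \<forall>i. \<beta> $ i \<in> {-1..1}}"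

definition F_radius :: "('n::finite, 'q::finite) zonotope \<Rightarrow> real" where
  "F_radius Z = 1 / real CARD('n) * sqrt (\<Sum>i\<in>UNIV. \<Sum>j\<in>UNIV. (generators Z $ i $ j)\<^sup>2)"

definition set_loss ::
  "(real ^ 'n \<Rightarrow> real ^ 'n \<Rightarrow> real) \<Rightarrow> real \<Rightarrow> real \<Rightarrow> real ^ 'n \<Rightarrow>
    ('n::finite, 'q::finite) zonotope \<Rightarrow> real" where
  "set_loss L \<tau> \<epsilon> t Y = (1 - \<tau>) * L t (center Y) + \<tau> / \<epsilon> * F_radius Y"

text \<open>
  Partial derivatives are derivatives at \<open>0\<close> along the coordinate axes. Since \<^const>\<open>deriv\<close> is a
  total function with an unspecified value where no derivative exists, existence of the partial
  derivatives is a separate predicate.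
\<close>

definition has_partials :: "(real ^ 'n \<Rightarrow> real) \<Rightarrow> real ^ 'n \<Rightarrow> bool" where
  "has_partials f c \<longleftrightarrow> (\<forall>i. (\<lambda>h. f (c + h *\<^sub>R axis i 1)) field_differentiable at 0)"

definition gradient :: "(real ^ 'n \<Rightarrow> real) \<Rightarrow> real ^ 'n \<Rightarrow> real ^ 'n" where
  "gradient f c = (\<chi> i. deriv (\<lambda>h. f (c + h *\<^sub>R axis i 1)) 0)"

definition has_matrix_partials :: "(real ^ 'q ^ 'n \<Rightarrow> real) \<Rightarrow> real ^ 'q ^ 'n \<Rightarrow> bool" where
  "has_matrix_partials f G \<longleftrightarrow>
    (\<forall>i j. (\<lambda>h. f (G + h *\<^sub>R axis i (axis j 1))) field_differentiable at 0)"

definition matrix_gradient :: "(real ^ 'q ^ 'n \<Rightarrow> real) \<Rightarrow> real ^ 'q ^ 'n \<Rightarrow> real ^ 'q ^ 'n" where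
  "matrix_gradient f G = (\<chi> i j. deriv (\<lambda>h. f (G + h *\<^sub>R axis i (axis j 1))) 0)"

definition has_zonotope_partials ::
  "(('n::finite, 'q::finite) zonotope \<Rightarrow> real) \<Rightarrow> ('n, 'q) zonotope \<Rightarrow> bool" where
  "has_zonotope_partials f Z \<longleftrightarrow>
    has_partials (\<lambda>c. f (Zonotope c (generators Z))) (center Z) \<and>
    has_matrix_partials (\<lambda>G. f (Zonotope (center Z) G)) (generators Z)"

definition zonotope_gradient ::
  "(('n::finite, 'q::finite) zonotope \<Rightarrow> real) \<Rightarrow> ('n, 'q) zonotope \<Rightarrow> ('n, 'q) zonotope" where
  "zonotope_gradient f Z =
    Zonotope (gradient (\<lambda>c. f (Zonotope c (generators Z))) (center Z))
      (matrix_gradient (\<lambda>G. f (Zonotope (center Z) G)) (generators Z))"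

end

theory Submission
  imports Defs
begin

text \<open>The loss splits into a term in the center only and a term in the generators only. The
  norm on nested vectors is the Frobenius norm, so the F-radius is \<open>norm G / n\<close> with
  \<open>n = CARD('n)\<close>. Away from 0 the norm has gradient \<open>G / norm G\<close>, hence
  the F-radius has gradient \<open>G / (n * norm G)\<close>. Substituting
  \<open>norm G = n * F_radius Y\<close> yields the second factor \<open>n\<close>: the coefficient
  carries the square of \<open>n\<close>, where the informal formula has its first power.\<close>

lemma F_radius_eq_norm: "F_radius (Zonotope c G) = norm G / real CARD('n)"
  for c :: "real ^ 'n::finite" and G :: "real ^ 'q::finite ^ 'n"
  by (simp add: F_radius_def norm_vec_def L2_set_def sum_nonneg)

lemma norm_has_field_derivative_along_line:
  fixes x v :: "'a::real_inner"
  assumes "x \<noteq> 0"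
  shows "((\<lambda>h. norm (x + h *\<^sub>R v)) has_field_derivative (x \<bullet> v) / norm x) (at 0)"
proof -
  have "((\<lambda>h::real. norm (x + h *\<^sub>R v)) has_derivative (\<lambda>h. sgn x \<bullet> (h *\<^sub>R v))) (at 0)"
    \<comment> \<open>Chain rule: for nonzero \<open>x\<close> the derivative of the norm at
      \<open>x\<close> is the inner product with \<open>sgn x\<close>.\<close>
    by (rule has_derivative_compose[where g = norm, THEN has_derivative_eq_rhs])
      (use assms in \<open>auto intro!: derivative_eq_intros has_derivative_norm simp: inner_commute\<close>)
  moreover have "(\<lambda>h. sgn x \<bullet> (h *\<^sub>R v)) = (*) ((x \<bullet> v) / norm x)"
    by (simp add: sgn_div_norm fun_eq_iff field_simps)
  ultimately show ?thesis
    by (simp add: has_field_derivative_def)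
qed

text \<open>The F-radius does not involve the center, so its term is constant in
  \<open>h\<close>.\<close>

lemma set_loss_center_partial:
  assumes "has_partials (L t) c"
  shows "((\<lambda>h. set_loss L \<tau> \<epsilon> t (Zonotope (c + h *\<^sub>R axis i 1) G)) has_field_derivative
    (1 - \<tau>) * gradient (L t) c $ i) (at 0)"
proof -
  have "((\<lambda>h. L t (c + h *\<^sub>R axis i 1)) has_field_derivative gradient (L t) c $ i) (at 0)"
    using assms by (simp add: has_partials_def gradient_def field_differentiable_derivI)
  then show ?thesis
    by (auto simp: set_loss_def F_radius_def intro!: derivative_eq_intros)
qed

lemma set_loss_generator_partial:
  fixes c :: "real ^ 'n::finite" and G :: "real ^ 'q::finite ^ 'n"
  assumes "F_radius (Zonotope c G) \<noteq> 0"
  shows "((\<lambda>h. set_loss L \<tau> \<epsilon> t (Zonotope c (G + h *\<^sub>R axis i (axis j 1)))) has_field_derivative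
    \<tau> / \<epsilon> * (1 / ((real CARD('n))\<^sup>2 * F_radius (Zonotope c G))) * G $ i $ j) (at 0)"
proof -
  \<comment> \<open>A nonzero F-radius keeps \<open>G\<close> away from the only point where the
    norm is not differentiable.\<close>
  have "G \<noteq> 0"
    using assms by (auto simp: F_radius_eq_norm)
  from norm_has_field_derivative_along_line[OF this, of "axis i (axis j 1)"]
  have "((\<lambda>h. norm (G + h *\<^sub>R axis i (axis j 1))) has_field_derivative G $ i $ j / norm G) (at 0)"
    \<comment> \<open>The inner product with a matrix unit reads off one entry of
      \<open>G\<close>.\<close>
    by (simp add: inner_axis)
  note DERIV_cmult[OF this, of "\<tau> / \<epsilon> / real CARD('n)"]
  from DERIV_add[OF DERIV_const[of "(1 - \<tau>) * L t c"] this] show ?thesis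
    by (simp add: set_loss_def F_radius_eq_norm power2_eq_square mult.assoc)
qed

theorem proposition9:
  fixes L :: "real ^ 'n::finite \<Rightarrow> real ^ 'n \<Rightarrow> real"
    and t c :: "real ^ 'n"
    and G :: "real ^ 'q::finite ^ 'n"
    and \<tau> \<epsilon> :: real
    and Y :: "('n, 'q) zonotope"
  assumes "\<tau> \<in> {0..1}" and "\<epsilon> > 0"
    and "Y = Zonotope c G"
    and "has_partials (L t) c"
    and "F_radius Y \<noteq> 0"
  shows "has_zonotope_partials (set_loss L \<tau> \<epsilon> t) Y \<and>
    zonotope_gradient (set_loss L \<tau> \<epsilon> t) Y =
      Zonotope ((1 - \<tau>) *\<^sub>R gradient (L t) c)
        ((\<tau> / \<epsilon> * (1 / ((real CARD('n))\<^sup>2 * F_radius Y))) *\<^sub>R G)"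
proof
  have F: "F_radius (Zonotope c G) \<noteq> 0"
    using assms by simp
  \<comment> \<open>Each fact gives both the existence and the value of a partial derivative,
    serving both conjuncts.\<close>
  note partials = set_loss_center_partial[of L t c, OF assms(4)] set_loss_generator_partial[OF F]
  show "has_zonotope_partials (set_loss L \<tau> \<epsilon> t) Y"
    unfolding assms(3) has_zonotope_partials_def has_partials_def has_matrix_partials_def
      field_differentiable_def zonotope.sel
    using partials by blast
  show "zonotope_gradient (set_loss L \<tau> \<epsilon> t) Y =
      Zonotope ((1 - \<tau>) *\<^sub>R gradient (L t) c)
        ((\<tau> / \<epsilon> * (1 / ((real CARD('n))\<^sup>2 * F_radius Y))) *\<^sub>R G)"
    unfolding assms(3) zonotope_gradient_def matrix_gradient_def zonotope.sel
    \<comment> \<open>The instance unfolds the gradient of the loss but leaves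
      \<open>gradient (L t) c\<close> folded, as in \<open>partials\<close>.\<close>
    by (simp add: gradient_def[of "\<lambda>c. set_loss L \<tau> \<epsilon> t (Zonotope c G)"]
        partials[THEN DERIV_imp_deriv] vec_eq_iff)
qed

end
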